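(* Let $b\ge2$ be an integer with $b\equiv 180\pmod{11184810}$ and let $t$ be a positive integer with $t\equiv 171\pmod{240}$. Then the $b$-repdigit $101_b^{(t)}=101(b^t-1)/(b-1)$ is a Riesel number.
   Context: For integers $b\ge2$, $1\le k<b$, $t\ge1$, the $b$-repdigit $k_b^{(t)}$ is $k(b^t-1)/(b-1)$. A Riesel number is an odd positive integer $k$ such that $k\cdot 2^n-1$ is composite for all positive integers $n$. *)

theory Defs
  imports "HOL-Number_Theory.Number_Theory"
begin

text \<open>
  The intended range is \<open>2 \<le> b\<close>, \<open>1 \<le> k < b\<close> and \<open>1 \<le> t\<close>. There the truncated subtractions
  are genuine and the division is exact, as the lemma below shows.
\<close>

definition repdigit :: "nat \<Rightarrow> nat \<Rightarrow> nat \<Rightarrow> nat" where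
  "repdigit b k t = k * (b ^ t - 1) div (b - 1)"

lemma repdigit_eq_sum:
  assumes "b \<ge> 2"
  shows "repdigit b k t = (\<Sum>i<t. k * b ^ i)"
proof -
  have "int (b ^ t - 1) = int ((b - 1) * (\<Sum>i<t. b ^ i))"
    using assms power_diff_1_eq[of "int b" t] by (simp add: of_nat_diff)
  then have "b ^ t - 1 = (b - 1) * (\<Sum>i<t. b ^ i)"
    by (simp only: of_nat_eq_iff)
  then have "k * (b ^ t - 1) = (\<Sum>i<t. k * b ^ i) * (b - 1)"
    by (simp add: sum_distrib_left mult_ac)
  then show ?thesis
    using assms by (simp add: repdigit_def)
qed

definition composite :: "nat \<Rightarrow> bool" where
  "composite m \<longleftrightarrow> m > 1 \<and> \<not> prime m"

definition riesel_number :: "nat \<Rightarrow> bool" where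
  "riesel_number k \<longleftrightarrow> odd k \<and> (\<forall>n>0. composite (k * 2 ^ n - 1))"

end

theory Submission
  imports Defs
begin

text \<open>
  Put \<open>M = 11184810 = 2 \<cdot> 3 \<cdot> 5 \<cdot> 7 \<cdot> 13 \<cdot> 17 \<cdot> 241\<close>. The repdigit \<open>r\<close> satisfies
  \<open>r (b - 1) = 101 (b ^ t - 1)\<close>. Since \<open>180 ^ (n + 240) \<equiv> 180 ^ n\<close> modulo \<open>M\<close> for \<open>n > 0\<close>
  and \<open>179\<close> is invertible modulo \<open>M\<close>, the hypotheses determine \<open>r\<close> modulo \<open>M\<close>, namely
  \<open>r \<equiv> 762701\<close>; in particular \<open>r\<close> is odd. The number \<open>2\<close> has order \<open>24\<close> modulo \<open>M div 2\<close>, and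
  for each of the \<open>24\<close> classes of \<open>n\<close> one of the primes \<open>3, 5, 7, 13, 17, 241\<close> divides
  \<open>762701 \<cdot> 2 ^ n - 1\<close>. As \<open>r \<ge> 762701\<close>, this is a proper divisor of \<open>r \<cdot> 2 ^ n - 1\<close>.
\<close>

text \<open>Both sides equal \<open>repdigit b k (t + 1)\<close>: the extra digit \<open>k\<close>
  enters at the low or at the high end.\<close>

lemma repdigit_recurrence:
  assumes "b \<ge> 2"
  shows "repdigit b k t * b + k = k * b ^ t + repdigit b k t"
  unfolding repdigit_eq_sum[OF assms] by (induction t) (simp_all add: algebra_simps)

text \<open>The offset \<open>s\<close> admits bases not coprime to \<open>m\<close>, such as 180
  modulo 11184810.\<close>

lemma cong_power_add_mult:
  fixes a m :: nat
  assumes "[a ^ (s + d) = a ^ s] (mod m)"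
  shows "[a ^ (s + d * q) = a ^ s] (mod m)"
proof (induction q)
  case (Suc q)
  have "[a ^ (s + d) * a ^ (d * q) = a ^ s * a ^ (d * q)] (mod m)"
    using assms by (rule cong_mult) simp
  then have "[a ^ (s + d * Suc q) = a ^ (s + d * q)] (mod m)"
    by (simp add: power_add mult_ac)
  then show ?case
    using Suc.IH by (rule cong_trans)
qed simp

text \<open>
  Modular exponentiation by repeated squaring; used as rewrite rules, these keep all
  intermediate numerals small.
\<close>

lemma power_numeral_mod:
  fixes a m :: nat
  shows "a ^ numeral (Num.Bit0 w) mod m = (a * a mod m) ^ numeral w mod m"
    and "a ^ numeral (Num.Bit1 w) mod m = a * ((a * a mod m) ^ numeral w mod m) mod m"
proof -
  have eq: "(a * a mod m) ^ numeral w mod m = (a ^ numeral w * a ^ numeral w) mod m"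
    by (simp add: power_mod power_mult_distrib)
  show "a ^ numeral (Num.Bit0 w) mod m = (a * a mod m) ^ numeral w mod m"
    unfolding eq by (simp only: power_numeral_even Let_def)
  show "a ^ numeral (Num.Bit1 w) mod m = a * ((a * a mod m) ^ numeral w mod m) mod m"
    unfolding eq by (simp only: power_numeral_odd Let_def mod_mult_right_eq mult.assoc)
qed

lemma repdigit_101_cong:
  assumes "b \<ge> 2" and b: "[b = 180] (mod 11184810)" and t: "[t = 171] (mod 240)"
  shows "[repdigit b 101 t = 762701] (mod 11184810)"
proof -
  let ?M = "11184810 :: nat"
  define r where "r = repdigit b 101 t"
  have "t mod 240 = 171"
    using t by (simp add: cong_def)
  then have t_eq: "t = 171 + 240 * (t div 240)"
    using mod_mult_div_eq[of t 240] by simp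
  have pow_171: "[180 ^ 171 = 1573200] (mod ?M)"
    by (simp add: cong_def power_numeral_mod del: power_numeral)
  have "[180 ^ (171 + 240) = 180 ^ 171] (mod ?M)"
    by (simp add: cong_def power_numeral_mod del: power_numeral)
  then have "[180 ^ t = 180 ^ 171] (mod ?M)"
    by (subst t_eq) (rule cong_power_add_mult)
  with pow_171 have "[180 ^ t = 1573200] (mod ?M)"
    by (rule cong_trans[rotated])
  with cong_pow[OF b] have "[b ^ t = 1573200] (mod ?M)"
    by (rule cong_trans)
  then have pow_t: "[101 * b ^ t + r = 101 * 1573200 + r] (mod ?M)"
    by (intro cong_add cong_mult cong_refl)
  have "[r * 180 + 101 = r * b + 101] (mod ?M)"
    using cong_sym[OF b] by (intro cong_add cong_mult cong_refl)
  also have "r * b + 101 = 101 * b ^ t + r"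
    unfolding r_def by (rule repdigit_recurrence) fact
  also note pow_t
  finally have "[r * 180 + 101 = 101 * 1573200 + r] (mod ?M)" .
  \<comment> \<open>Here 158893099 = 101 * 1573200 - 101.\<close>
  then have "[179 * r + (r + 101) = 158893099 + (r + 101)] (mod ?M)"
    by (simp add: algebra_simps)
  then have "[179 * r = 158893099] (mod ?M)"
    by (simp only: cong_add_rcancel_nat)
  also have "[158893099 = 179 * 762701] (mod ?M)"
    by (simp add: cong_def)
  finally have "[r = 762701] (mod ?M)"
    by (rule cong_mult_lcancel_nat[THEN iffD1, rotated]) (simp add: coprime_iff_gcd_eq_1 gcd_non_0_nat)
  then show ?thesis
    by (simp add: r_def)
qed

lemma covering_prime:
  fixes r n :: nat
  assumes r: "[r = 762701] (mod 5592405)"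
  shows "\<exists>p\<in>{3, 5, 7, 13, 17, 241}. [r * 2 ^ n = 1] (mod p)"
proof -
  define s where "s = n mod 24"
  have "[2 ^ (s + 24) = 2 ^ s] (mod (5592405 :: nat))"
    unfolding power_add by (rule cong_scalar_left[of _ 1, simplified]) (simp add: cong_def)
  then have "[2 ^ (s + 24 * (n div 24)) = 2 ^ s] (mod (5592405 :: nat))"
    by (rule cong_power_add_mult)
  then have "[2 ^ n = 2 ^ s] (mod (5592405 :: nat))"
    by (simp add: s_def)
  with r have *: "[r * 2 ^ n = 762701 * 2 ^ s] (mod 5592405)"
    by (rule cong_mult)
  have "s \<in> {..<24}"
    by (simp add: s_def)
  \<comment> \<open>The covering of \<open>s\<close>: 1 mod 2 by 3, 0 mod 4 by 5, 2 mod 3 by 7, 10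
    mod 12 by 13, 2 mod 8 by 17, 6 mod 24 by 241.\<close>
  then have "\<exists>p\<in>{3, 5, 7, 13, 17, 241}. [762701 * 2 ^ s = 1] (mod (p :: nat))"
    by (simp add: lessThan_nat_numeral lessThan_Suc cong_def) (elim disjE; simp)
  then obtain p :: nat where p: "p \<in> {3, 5, 7, 13, 17, 241}" "[762701 * 2 ^ s = 1] (mod p)"
    by blast
  have "p dvd 5592405"
    using p(1) by auto
  with * have "[r * 2 ^ n = 762701 * 2 ^ s] (mod p)"
    by (rule cong_dvd_modulus_nat)
  with p show ?thesis
    using cong_trans by blast
qed

theorem theorem3p10:
  fixes b t :: nat
  assumes "b \<ge> 2"
    and "[b = 180] (mod 11184810)"
    and "t > 0"
    and "[t = 171] (mod 240)"
  shows "riesel_number (repdigit b 101 t)"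
proof -
  define r where "r = repdigit b 101 t"
  have r: "[r = 762701] (mod 11184810)"
    unfolding r_def using assms by (intro repdigit_101_cong)
  have "[r = 762701] (mod 2)"
    using r by (rule cong_dvd_modulus_nat) simp
  then have odd: "odd r"
    by (simp add: cong_def odd_iff_mod_2_eq_one)
  have large: "r \<ge> 762701"
    using r mod_less_eq_dividend[of r 11184810] by (simp add: cong_def)
  have "composite (r * 2 ^ n - 1)" for n
  proof -
    let ?m = "r * 2 ^ n - 1"
    have "r * 1 \<le> r * 2 ^ n"
      by (intro mult_left_mono) simp_all
    with large have m: "?m > 241" "r * 2 ^ n \<ge> 1"
      by linarith+
    have "[r = 762701] (mod 5592405)"
      using r by (rule cong_dvd_modulus_nat) simp
    then obtain p where p: "p \<in> {3, 5, 7, 13, 17, 241}" "[r * 2 ^ n = 1] (mod p)"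
      using covering_prime by blast
    have "p dvd ?m"
      using p(2) m(2) by (simp add: cong_altdef_nat)
    moreover have "1 < p" "p < ?m"
      using p(1) m(1) by auto
    ultimately show ?thesis
      using m(1) by (auto simp: composite_def prime_nat_iff)
  qed
  with odd show ?thesis
    by (simp add: riesel_number_def r_def)
qed

end
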